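(* For $s>0$ let $p_s(x)=\frac{s}{\pi(s^2+x^2)}$, $x\in\mathbb{R}$, be the scale Cauchy density with scale $s$. Then for all $s,s_1,s_2>0$, the differential entropy, cross-entropy and Kullback-Leibler divergence are $$h(p_s)=\log(4\pi s),$$ $$h^\times(p_{s_1}:p_{s_2})=\log\left(\pi\,\frac{(s_1+s_2)^2}{s_2}\right),$$ $$\mathrm{KL}(p_{s_1}:p_{s_2})=2\log\left(\frac{s_1+s_2}{2\sqrt{s_1s_2}}\right).$$
   Context: For probability densities $p,q$ on $\mathbb{R}$: the cross-entropy is $h^\times(p:q)=-\int_{\mathbb{R}}p(x)\log q(x)\,dx$, the differential entropy is $h(p)=h^\times(p:p)$, and the Kullback-Leibler divergence is $\mathrm{KL}(p:q)=h^\times(p:q)-h(p)=\int_{\mathbb{R}}p(x)\log\frac{p(x)}{q(x)}\,dx$. Here $\log$ is the natural logarithm. *)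

theory Defs
  imports "HOL-Probability.Information"
begin

definition cauchy_scale_density :: "real \<Rightarrow> real \<Rightarrow> real" where
  "cauchy_scale_density s x = s / (pi * (s\<^sup>2 + x\<^sup>2))"

(* Densities are with respect to Lebesgue measure and all integrals are Lebesgue integrals.
   LINT is 0 for a non-integrable integrand, so each of these quantities is meaningful only
   together with integrability of its integrand. *)

definition cross_entropy :: "(real \<Rightarrow> real) \<Rightarrow> (real \<Rightarrow> real) \<Rightarrow> real" where
  "cross_entropy p q = - (LINT x|lborel. p x * ln (q x))"

definition differential_entropy :: "(real \<Rightarrow> real) \<Rightarrow> real" where
  "differential_entropy p = cross_entropy p p"

definition kl_div :: "(real \<Rightarrow> real) \<Rightarrow> (real \<Rightarrow> real) \<Rightarrow> real" where
  "kl_div p q = (LINT x|lborel. p x * ln (p x / q x))"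

lemma kl_div_eq_cross_entropy_minus_entropy:
  assumes pos: "\<And>x. 0 < p x" "\<And>x. 0 < q x"
    and "integrable lborel (\<lambda>x. p x * ln (q x))"
    and "integrable lborel (\<lambda>x. p x * ln (p x))"
  shows "kl_div p q = cross_entropy p q - differential_entropy p"
proof -
  have "p x * ln (p x / q x) = p x * ln (p x) - p x * ln (q x)" for x
    using pos[of x] by (simp add: ln_div right_diff_distrib)
  then show ?thesis
    using assms(3,4)
    by (simp add: kl_div_def cross_entropy_def differential_entropy_def)
qed

(* The library's KL_divergence takes the reference measure first, and the logarithm base
   as a parameter. *)
lemma kl_div_eq_KL_divergence:
  assumes [measurable]: "p \<in> borel_measurable borel" "q \<in> borel_measurable borel"
    and pos: "\<And>x. 0 < p x" "\<And>x. 0 < q x"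
  shows "kl_div p q = KL_divergence (exp 1) (density lborel q) (density lborel p)"
proof -
  have "KL_divergence (exp 1) (density lborel q) (density lborel p)
      = (LINT x|lborel. p x * log (exp 1) (p x / q x))"
    using pos
    by (intro lborel.KL_density_density)
       (auto simp: less_imp_le intro!: AE_I2 dest: less_imp_neq[symmetric])
  then show ?thesis
    by (simp add: kl_div_def log_def)
qed

end

theory Submission
  imports Defs
begin

text \<open>
  Write \<open>p\<^sub>s\<close> for the Cauchy density with scale \<open>s\<close>.
  Since \<open>p\<^sub>b x = 1 / (\<pi> b (1 + x\<^sup>2 / b\<^sup>2))\<close> and \<open>p\<^sub>a\<close> has mass one, every assertion follows from

  \<open>\<integral> p\<^sub>a x ln (1 + x\<^sup>2 / b\<^sup>2) dx = 2 ln (1 + a / b)\<close>.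

  To evaluate this integral, the logarithm is spread over an auxiliary scale \<open>t\<close>,

  \<open>ln (1 + x\<^sup>2 / b\<^sup>2) = \<integral>\<^sub>b\<^sup>\<infinity> 2 x\<^sup>2 / (t (t\<^sup>2 + x\<^sup>2)) dt\<close>,

  and the order of integration is exchanged. For fixed \<open>t\<close> the integral over \<open>x\<close> is one of a
  rational function: partial fractions and arctangents give
  \<open>\<integral> p\<^sub>a x x\<^sup>2 / (t\<^sup>2 + x\<^sup>2) dx = a / (a + t)\<close>
  (\<open>has_bochner_integral_cauchy_scale_density_quotient\<close>). What remains is twice
  \<open>\<integral>\<^sub>b\<^sup>\<infinity> a / (t (t + a)) dt = ln (1 + a / b)\<close>, which is the same formula as the one for the
  logarithm above, with \<open>t\<close> in place of \<open>t\<^sup>2\<close>; both are instances of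
  \<open>nn_integral_atLeast_eq_ln_one_plus_quotient_power\<close>.

  All integrands are nonnegative, so Tonelli's theorem justifies the exchange without any
  prior bound, and the finite value obtained proves integrability at the same time. The
  entropy is the case \<open>a = b\<close>, and the divergence is the difference of cross-entropy and entropy.
\<close>

text \<open>
  For a nonnegative integrand, existence of the limits of an antiderivative at both ends already
  forces absolute integrability.
\<close>

lemma has_bochner_integral_FTC_real_line:
  fixes f F :: "real \<Rightarrow> real"
  assumes deriv: "\<And>x. (F has_real_derivative f x) (at x)"
    and cont: "\<And>x. isCont f x"
    and nonneg: "\<And>x. 0 \<le> f x"
    and lims: "(F \<longlongrightarrow> A) at_bot" "(F \<longlongrightarrow> B) at_top"
  shows "has_bochner_integral lborel f (B - A)"
proof -
  have *: "((F \<circ> real_of_ereal) \<longlongrightarrow> A) (at_right (-\<infinity>))"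
    "((F \<circ> real_of_ereal) \<longlongrightarrow> B) (at_left \<infinity>)"
    using lims by (simp_all add: ereal_tendsto_simps)
  have "set_integrable lborel (einterval (-\<infinity>) \<infinity>) f"
    "(LBINT x=-\<infinity>..\<infinity>. f x) = B - A"
    by (rule interval_integral_FTC_nonneg[where F=F and A=A and B=B];
        use deriv cont nonneg * in simp)+
  then show ?thesis
    by (simp add: has_bochner_integral_iff interval_lebesgue_integral_def
        set_integrable_def set_lebesgue_integral_def)
qed

lemma cauchy_scale_density_pos: "0 < s \<Longrightarrow> 0 < cauchy_scale_density s x"
  by (simp add: cauchy_scale_density_def add_pos_nonneg)

lemma isCont_cauchy_scale_density: "0 < s \<Longrightarrow> isCont (cauchy_scale_density s) x"
  unfolding cauchy_scale_density_def
  by (intro continuous_intros) (simp add: add_pos_nonneg less_imp_neq[symmetric])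

lemma borel_measurable_cauchy_scale_density [measurable]:
  "cauchy_scale_density s \<in> borel_measurable borel"
  unfolding cauchy_scale_density_def by measurable

lemma has_real_derivative_arctan_scaled:
  fixes s x :: real
  assumes "0 < s"
  shows "((\<lambda>x. arctan (x / s)) has_real_derivative s / (s\<^sup>2 + x\<^sup>2)) (at x)"
proof -
  have "0 < s\<^sup>2 + x\<^sup>2" using assms by (simp add: add_pos_nonneg)
  then have "inverse (1 + (x / s)\<^sup>2) * (1 / s) = s / (s\<^sup>2 + x\<^sup>2)"
    using assms by (simp add: field_simps power2_eq_square)
  moreover have "((\<lambda>x. arctan (x / s)) has_real_derivative inverse (1 + (x / s)\<^sup>2) * (1 / s)) (at x)"
    using assms by (auto intro!: derivative_eq_intros)
  ultimately show ?thesis by simp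
qed

lemma arctan_scaled_limits:
  fixes s :: real
  assumes "0 < s"
  shows "((\<lambda>x. arctan (x / s)) \<longlongrightarrow> pi / 2) at_top"
    and "((\<lambda>x. arctan (x / s)) \<longlongrightarrow> - (pi / 2)) at_bot"
proof -
  have "filterlim (\<lambda>x. x / s) at_top at_top"
    using filterlim_tendsto_pos_mult_at_top[OF tendsto_const[of "1/s"] _ filterlim_ident] assms
    by simp
  then show "((\<lambda>x. arctan (x / s)) \<longlongrightarrow> pi / 2) at_top"
    by (rule filterlim_compose[OF tendsto_arctan_at_top])
  have "filterlim (\<lambda>x. x / s) at_bot at_bot"
    using filterlim_tendsto_pos_mult_at_bot[OF tendsto_const[of "1/s"] _ filterlim_ident] assms
    by simp
  then show "((\<lambda>x. arctan (x / s)) \<longlongrightarrow> - (pi / 2)) at_bot"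
    by (rule filterlim_compose[OF tendsto_arctan_at_bot])
qed

lemma has_bochner_integral_cauchy_scale_density:
  assumes "0 < s"
  shows "has_bochner_integral lborel (cauchy_scale_density s) 1"
proof -
  have "has_bochner_integral lborel (cauchy_scale_density s)
      (1 / pi * (pi / 2) - 1 / pi * - (pi / 2))"
  proof (rule has_bochner_integral_FTC_real_line[where F = "\<lambda>x. 1 / pi * arctan (x / s)"])
    show "((\<lambda>x. 1 / pi * arctan (x / s)) \<longlongrightarrow> 1 / pi * - (pi / 2)) at_bot"
      "((\<lambda>x. 1 / pi * arctan (x / s)) \<longlongrightarrow> 1 / pi * (pi / 2)) at_top"
      by (intro tendsto_mult_left arctan_scaled_limits assms)+
    show "((\<lambda>x. 1 / pi * arctan (x / s)) has_real_derivative cauchy_scale_density s x) (at x)" for x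
      using DERIV_cmult[OF has_real_derivative_arctan_scaled[OF assms, of x], of "1 / pi"]
      by (simp add: cauchy_scale_density_def)
  qed (use assms cauchy_scale_density_pos isCont_cauchy_scale_density in
      \<open>auto intro: less_imp_le\<close>)
  then show ?thesis by simp
qed

text \<open>
  The constant \<open>c\<close> in the proof comes from the partial fraction decomposition
  \<open>(s\<^sup>2 - t\<^sup>2) x\<^sup>2 / ((s\<^sup>2 + x\<^sup>2) (t\<^sup>2 + x\<^sup>2)) = s\<^sup>2 / (s\<^sup>2 + x\<^sup>2) - t\<^sup>2 / (t\<^sup>2 + x\<^sup>2)\<close>,
  which degenerates at \<open>s = t\<close>. Excluding that case is harmless: a single value of \<open>t\<close> is
  negligible for the integration over \<open>t\<close> that follows.
\<close>

lemma has_bochner_integral_cauchy_scale_density_quotient: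
  assumes s: "0 < s" and t: "0 < t" and "s \<noteq> t"
  shows "has_bochner_integral lborel
    (\<lambda>x. cauchy_scale_density s x * (x\<^sup>2 / (t\<^sup>2 + x\<^sup>2))) (s / (s + t))"
proof -
  define c where "c = s / (pi * (s\<^sup>2 - t\<^sup>2))"
  define F where "F x = c * (s * arctan (x / s) - t * arctan (x / t))" for x
  have ne: "s\<^sup>2 - t\<^sup>2 \<noteq> 0"
    using assms by (simp add: power2_eq_iff_nonneg)
  have pos: "0 < s\<^sup>2 + x\<^sup>2" "0 < t\<^sup>2 + x\<^sup>2" for x
    using s t by (simp_all add: add_pos_nonneg)
  have "has_bochner_integral lborel
      (\<lambda>x. cauchy_scale_density s x * (x\<^sup>2 / (t\<^sup>2 + x\<^sup>2)))
      (c * (s * (pi / 2) - t * (pi / 2)) - c * (s * - (pi / 2) - t * - (pi / 2)))"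
  proof (rule has_bochner_integral_FTC_real_line[where F = F])
    fix x
    have "c * (s * (s / (s\<^sup>2 + x\<^sup>2)) - t * (t / (t\<^sup>2 + x\<^sup>2)))
        = cauchy_scale_density s x * (x\<^sup>2 / (t\<^sup>2 + x\<^sup>2))"
    proof -
      have "s * (s / (s\<^sup>2 + x\<^sup>2)) - t * (t / (t\<^sup>2 + x\<^sup>2))
          = (s\<^sup>2 - t\<^sup>2) * x\<^sup>2 / ((s\<^sup>2 + x\<^sup>2) * (t\<^sup>2 + x\<^sup>2))"
        using pos(1)[of x, THEN less_imp_neq] pos(2)[of x, THEN less_imp_neq]
        by (simp add: divide_simps) (simp add: algebra_simps power2_eq_square)
      then show ?thesis
        using ne by (simp add: c_def cauchy_scale_density_def mult.assoc)
    qed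
    then show "(F has_real_derivative cauchy_scale_density s x * (x\<^sup>2 / (t\<^sup>2 + x\<^sup>2))) (at x)"
      unfolding F_def
      using DERIV_cmult[OF DERIV_diff[OF
            DERIV_cmult[OF has_real_derivative_arctan_scaled[OF s, of x], of s]
            DERIV_cmult[OF has_real_derivative_arctan_scaled[OF t, of x], of t]], of c]
      by simp
    show "isCont (\<lambda>x. cauchy_scale_density s x * (x\<^sup>2 / (t\<^sup>2 + x\<^sup>2))) x"
      using pos(2)[of x]
      by (intro continuous_intros isCont_cauchy_scale_density s) linarith
    show "0 \<le> cauchy_scale_density s x * (x\<^sup>2 / (t\<^sup>2 + x\<^sup>2))"
      using pos(2)[of x] cauchy_scale_density_pos[OF s, of x] by simp
  next
    show "(F \<longlongrightarrow> c * (s * - (pi / 2) - t * - (pi / 2))) at_bot"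
      "(F \<longlongrightarrow> c * (s * (pi / 2) - t * (pi / 2))) at_top"
      unfolding F_def by (intro tendsto_mult_left tendsto_diff arctan_scaled_limits s t)+
  qed
  moreover have "c * (s * (pi / 2) - t * (pi / 2)) - c * (s * - (pi / 2) - t * - (pi / 2))
      = s / (s + t)"
  proof -
    have "s\<^sup>2 - t\<^sup>2 = (s + t) * (s - t)" by (simp add: algebra_simps power2_eq_square)
    then show ?thesis using assms by (simp add: c_def divide_simps) (simp add: algebra_simps)
  qed
  ultimately show ?thesis by simp
qed

text \<open>
  The integrand is the derivative of \<open>- ln (1 + c / t\<^sup>n)\<close>, which tends to \<open>0\<close> at infinity.
  The case \<open>n = 2\<close>, \<open>c = x\<^sup>2\<close> opens up the logarithm before the exchange of integrals; the case
  \<open>n = 1\<close>, \<open>c = a\<close> closes it again afterwards.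
\<close>

lemma nn_integral_atLeast_eq_ln_one_plus_quotient_power:
  fixes b c :: real
  assumes b: "0 < b" and c: "0 \<le> c" and n: "0 < n"
  shows "(\<integral>\<^sup>+t. ennreal (real n * c / (t * (t ^ n + c))) * indicator {b..} t \<partial>lborel)
    = ennreal (ln (1 + c / b ^ n))"
proof -
  have "(\<integral>\<^sup>+t. ennreal (real n * c / (t * (t ^ n + c))) * indicator {b..} t \<partial>lborel)
    = ennreal (0 - (- ln (1 + c / b ^ n)))"
  proof (rule nn_integral_FTC_atLeast[where F = "\<lambda>t. - ln (1 + c / t ^ n)"])
    fix t assume "b \<le> t"
    then have t: "0 < t" using b by simp
    have pos: "0 < 1 + c / t ^ n" using t c by (simp add: add_pos_nonneg)
    have "((\<lambda>t. - ln (1 + c / t ^ n)) has_real_derivative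
        - (1 / (1 + c / t ^ n) * (- (c * (real n * t ^ (n - 1))) / (t ^ n * t ^ n)))) (at t)"
      using t pos by (auto intro!: derivative_eq_intros)
    moreover have "- (1 / (1 + c / t ^ n) * (- (c * (real n * t ^ (n - 1))) / (t ^ n * t ^ n)))
        = real n * c / (t * (t ^ n + c))"
    proof -
      have "1 + c / t ^ n = (t ^ n + c) / t ^ n" using t by (simp add: field_simps)
      moreover have "0 < t ^ n + c" using t c by (simp add: add_pos_nonneg)
      moreover have "t ^ (n - 1) = t ^ n / t" using t n by (simp add: power_diff)
      ultimately show ?thesis using t by (simp add: divide_simps)
    qed
    ultimately show "((\<lambda>t. - ln (1 + c / t ^ n)) has_real_derivative
        real n * c / (t * (t ^ n + c))) (at t)" by simp
    show "0 \<le> real n * c / (t * (t ^ n + c))" using t c by simp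
  next
    have "((\<lambda>t. - ln (1 + c / t ^ n)) \<longlongrightarrow> - ln (1 + 0)) at_top"
      using n by (intro tendsto_intros tendsto_divide_0[OF tendsto_const]
          filterlim_at_top_imp_at_infinity filterlim_pow_at_top filterlim_ident) simp_all
    then show "((\<lambda>t. - ln (1 + c / t ^ n)) \<longlongrightarrow> 0) at_top" by simp
  qed simp
  then show ?thesis by simp
qed

lemma nn_integral_cauchy_scale_density_ln_one_plus:
  assumes a: "0 < a" and b: "0 < b"
  shows "(\<integral>\<^sup>+x. ennreal (cauchy_scale_density a x * ln (1 + x\<^sup>2 / b\<^sup>2)) \<partial>lborel)
    = ennreal (2 * ln (1 + a / b))"
proof -
  let ?p = "cauchy_scale_density a"
  let ?k = "\<lambda>t x. ennreal (?p x * (2 * x\<^sup>2 / (t * (t\<^sup>2 + x\<^sup>2)))) * indicator {b..} t"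
  have p: "0 \<le> ?p x" for x
    using cauchy_scale_density_pos[OF a] by (simp add: less_imp_le)
  have "(\<integral>\<^sup>+x. ennreal (?p x * ln (1 + x\<^sup>2 / b\<^sup>2)) \<partial>lborel)
      = (\<integral>\<^sup>+x. (\<integral>\<^sup>+t. ?k t x \<partial>lborel) \<partial>lborel)"
  proof (rule nn_integral_cong)
    fix x :: real
    have "ennreal (?p x * ln (1 + x\<^sup>2 / b\<^sup>2))
        = ennreal (?p x) * (\<integral>\<^sup>+t. ennreal (2 * x\<^sup>2 / (t * (t\<^sup>2 + x\<^sup>2))) * indicator {b..} t \<partial>lborel)"
      using nn_integral_atLeast_eq_ln_one_plus_quotient_power[OF b, of "x\<^sup>2" 2] p
      by (simp add: ennreal_mult')
    also have "\<dots> = (\<integral>\<^sup>+t. ?k t x \<partial>lborel)"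
      using p by (subst nn_integral_cmult[symmetric])
        (simp_all add: ennreal_mult' mult.assoc del: times_divide_eq_right)
    finally show "ennreal (?p x * ln (1 + x\<^sup>2 / b\<^sup>2)) = (\<integral>\<^sup>+t. ?k t x \<partial>lborel)" .
  qed
  also have "\<dots> = (\<integral>\<^sup>+t. (\<integral>\<^sup>+x. ?k t x \<partial>lborel) \<partial>lborel)"
    by (rule lborel_pair.Fubini') measurable
  \<comment> \<open>The inner integral is only known for \<open>t \<noteq> a\<close>, hence the equality almost everywhere.\<close>
  also have "\<dots> = (\<integral>\<^sup>+t. 2 * (ennreal (a / (t * (t + a))) * indicator {b..} t) \<partial>lborel)"
  proof (rule nn_integral_cong_AE)
    have "(\<integral>\<^sup>+x. ?k t x \<partial>lborel) = 2 * (ennreal (a / (t * (t + a))) * indicator {b..} t)"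
      if "t \<noteq> a" for t
    proof (cases "b \<le> t")
      case True
      then have t: "0 < t" using b by simp
      have "has_bochner_integral lborel (\<lambda>x. 2 / t * (?p x * (x\<^sup>2 / (t\<^sup>2 + x\<^sup>2))))
          (2 / t * (a / (a + t)))"
        using that has_bochner_integral_cauchy_scale_density_quotient[OF a t]
        by (intro has_bochner_integral_mult_right) auto
      then have "(\<integral>\<^sup>+x. ennreal (2 / t * (?p x * (x\<^sup>2 / (t\<^sup>2 + x\<^sup>2)))) \<partial>lborel)
          = ennreal (2 / t * (a / (a + t)))"
        using p t by (subst nn_integral_eq_integral)
          (auto simp: has_bochner_integral_iff simp del: times_divide_eq_left times_divide_eq_right)
      moreover have "2 / t * (?p x * (x\<^sup>2 / (t\<^sup>2 + x\<^sup>2))) = ?p x * (2 * x\<^sup>2 / (t * (t\<^sup>2 + x\<^sup>2)))"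
        for x by simp
      moreover have "ennreal (2 / t * (a / (a + t))) = 2 * ennreal (a / (t * (t + a)))"
        using ennreal_mult'[of 2 "a / (t * (t + a))"] by (simp add: add.commute)
      ultimately show ?thesis using True by (simp add: mult_ac)
    qed simp
    then show "AE t in lborel. (\<integral>\<^sup>+x. ?k t x \<partial>lborel)
        = 2 * (ennreal (a / (t * (t + a))) * indicator {b..} t)"
      using AE_lborel_singleton[of a] by (auto elim: eventually_mono)
  qed
  also have "\<dots> = ennreal (2 * ln (1 + a / b))"
    using nn_integral_atLeast_eq_ln_one_plus_quotient_power[OF b, of a 1] a
    by (simp add: nn_integral_cmult ennreal_mult')
  finally show ?thesis .
qed

lemma has_bochner_integral_cauchy_scale_density_ln:
  assumes a: "0 < a" and b: "0 < b"
  shows "has_bochner_integral lborel (\<lambda>x. cauchy_scale_density a x * ln (cauchy_scale_density b x))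
    (- ln (pi * ((a + b)\<^sup>2 / b)))"
proof -
  let ?p = "cauchy_scale_density a"
  have p: "0 \<le> ?p x" for x
    using cauchy_scale_density_pos[OF a] by (simp add: less_imp_le)
  have "has_bochner_integral lborel (\<lambda>x. ?p x * ln (1 + x\<^sup>2 / b\<^sup>2)) (2 * ln (1 + a / b))"
    using nn_integral_cauchy_scale_density_ln_one_plus[OF a b] p a b
    by (intro has_bochner_integral_nn_integral) auto
  then have "has_bochner_integral lborel
      (\<lambda>x. - ln (pi * b) * ?p x - ?p x * ln (1 + x\<^sup>2 / b\<^sup>2))
      (- ln (pi * b) * 1 - 2 * ln (1 + a / b))"
    by (intro has_bochner_integral_diff has_bochner_integral_mult_right
        has_bochner_integral_cauchy_scale_density a)
  moreover have "- ln (pi * b) * ?p x - ?p x * ln (1 + x\<^sup>2 / b\<^sup>2)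
      = ?p x * ln (cauchy_scale_density b x)" for x
  proof -
    have pos: "0 < 1 + x\<^sup>2 / b\<^sup>2" by (simp add: add_pos_nonneg)
    have "cauchy_scale_density b x = 1 / ((pi * b) * (1 + x\<^sup>2 / b\<^sup>2))"
    proof -
      have "(pi * b) * (1 + x\<^sup>2 / b\<^sup>2) = pi * (b\<^sup>2 + x\<^sup>2) / b"
        using b by (simp add: field_simps power2_eq_square)
      then show ?thesis by (simp add: cauchy_scale_density_def)
    qed
    also have "ln \<dots> = - (ln (pi * b) + ln (1 + x\<^sup>2 / b\<^sup>2))"
      using pos b by (simp add: ln_div ln_mult_pos)
    finally show ?thesis by (simp only:) (simp add: algebra_simps)
  qed
  moreover have "- ln (pi * b) * 1 - 2 * ln (1 + a / b) = - ln (pi * ((a + b)\<^sup>2 / b))"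
  proof -
    have "1 + a / b = (a + b) / b" using b by (simp add: field_simps)
    then show ?thesis using a b
      by (simp add: ln_div ln_mult_pos ln_realpow)
  qed
  ultimately show ?thesis by simp
qed

theorem proposition1:
  fixes s s1 s2 :: real
  assumes "s > 0" and "s1 > 0" and "s2 > 0"
  shows "integrable lborel (\<lambda>x. cauchy_scale_density s x * ln (cauchy_scale_density s x))
    \<and> differential_entropy (cauchy_scale_density s) = ln (4 * pi * s)
    \<and> integrable lborel (\<lambda>x. cauchy_scale_density s1 x * ln (cauchy_scale_density s2 x))
    \<and> cross_entropy (cauchy_scale_density s1) (cauchy_scale_density s2)
        = ln (pi * ((s1 + s2)\<^sup>2 / s2))
    \<and> integrable lborel
        (\<lambda>x. cauchy_scale_density s1 x * ln (cauchy_scale_density s1 x / cauchy_scale_density s2 x))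
    \<and> kl_div (cauchy_scale_density s1) (cauchy_scale_density s2)
        = 2 * ln ((s1 + s2) / (2 * sqrt (s1 * s2)))"
proof -
  let ?p = cauchy_scale_density
  have int: "integrable lborel (\<lambda>x. ?p a x * ln (?p b x))"
    and cross: "cross_entropy (?p a) (?p b) = ln (pi * ((a + b)\<^sup>2 / b))"
    if "0 < a" "0 < b" for a b
    using has_bochner_integral_cauchy_scale_density_ln[OF that]
    by (auto simp: has_bochner_integral_iff cross_entropy_def)
  have ent: "differential_entropy (?p a) = ln (4 * pi * a)" if "0 < a" for a
  proof -
    have "pi * ((a + a)\<^sup>2 / a) = 4 * pi * a"
      using that by (simp add: power2_eq_square)
    then show ?thesis
      using cross[OF that that] by (simp add: differential_entropy_def)
  qed
  have "?p s1 x * ln (?p s1 x / ?p s2 x) = ?p s1 x * ln (?p s1 x) - ?p s1 x * ln (?p s2 x)" for x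
    using cauchy_scale_density_pos[of s1 x] cauchy_scale_density_pos[of s2 x] assms
    by (simp add: ln_div right_diff_distrib)
  then have intkl: "integrable lborel (\<lambda>x. ?p s1 x * ln (?p s1 x / ?p s2 x))"
    using int assms by simp
  have "kl_div (?p s1) (?p s2) = cross_entropy (?p s1) (?p s2) - differential_entropy (?p s1)"
    using assms int by (intro kl_div_eq_cross_entropy_minus_entropy cauchy_scale_density_pos)
  also have "\<dots> = ln (pi * ((s1 + s2)\<^sup>2 / s2)) - ln (4 * pi * s1)"
    using assms by (simp add: cross ent)
  also have "\<dots> = 2 * ln ((s1 + s2) / (2 * sqrt (s1 * s2)))"
  proof -
    have "ln (4::real) = 2 * ln 2"
      using ln_realpow[of 2 2] by simp
    then show ?thesis
      using assms by (simp add: ln_div ln_mult_pos ln_realpow ln_sqrt) (simp add: field_simps)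
  qed
  finally show ?thesis
    using int cross ent intkl assms by blast
qed

end
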